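(* Let $\eta>0$ and define $P(\nu):=\mathrm{diag}(\sqrt{\nu}/\eta)$. For any $g\in\mathbb{R}^d$ and $H\in\mathrm{Sym}(\mathbb{R}^d)$, if $\nu\in\mathbb{R}^d$ and $\Sigma\in\mathrm{Sym}(\mathbb{R}^d)$ satisfy $$\nu = g^{\odot 2}+\tfrac{4}{\eta^2}\,\nu\odot\mathrm{diag}(\Sigma)\qquad\text{and}\qquad 0\preceq\Sigma\perp 2P(\nu)-H\succeq 0,$$ then $P(\nu)$ is an optimum for the convex program $$\operatorname*{arg\,min}_{P\ \text{diagonal},\ P\succeq 0}\ \ \mathrm{tr}(P)+\tfrac{1}{\eta^2}\,g^\top P^{-1}g\quad\text{such that}\quad H\preceq 2P .$$
   Context: $\mathrm{Sym}(\mathbb{R}^d)$ is the set of real symmetric $d\times d$ matrices. $\odot$ is the entrywise product, $g^{\odot2}$ the entrywise square, and $\sqrt{\nu}$ the entrywise square root. $\mathrm{diag}$ of a vector is the diagonal matrix with that diagonal, and $\mathrm{diag}$ of a matrix is the vector of its diagonal entries. $\preceq,\succeq$ denote the positive semidefinite order. For symmetric matrices, $0\preceq X\perp Y\succeq0$ is shorthand for $X\succeq0$, $Y\succeq0$ and $\mathrm{tr}(XY)=0$. For diagonal $P=\mathrm{diag}(p)$, $g^\top P^{-1}g=\sum_i g_i^2/p_i$.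
   Formalization: The formal theorem additionally assumes that all entries of ν are strictly positive, so that P(ν) is invertible; with zero entries of ν the inverse in the objective is undefined and, reading 0/0 as 0, optimality can fail. *)

theory Defs
  imports "HOL-Analysis.Analysis"
begin

text \<open>
  On \<open>real ^ 'n\<close> the type-class operations \<open>*\<close> and \<open>^\<close> act entrywise; on matrices the
  product is \<open>**\<close> and the scalar multiple is \<open>*\<^sub>R\<close>.
\<close>

definition symmetric :: "real ^ 'n ^ 'n \<Rightarrow> bool" where
  "symmetric X \<longleftrightarrow> transpose X = X"

definition psd :: "real ^ 'n ^ 'n \<Rightarrow> bool" where
  "psd X \<longleftrightarrow> symmetric X \<and> (\<forall>x. 0 \<le> x \<bullet> (X *v x))"

definition loewner_le :: "real ^ 'n ^ 'n \<Rightarrow> real ^ 'n ^ 'n \<Rightarrow> bool" (infix \<open>\<preceq>\<close> 50) where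
  "X \<preceq> Y \<longleftrightarrow> psd (Y - X)"

definition psd_perp :: "real ^ 'n ^ 'n \<Rightarrow> real ^ 'n ^ 'n \<Rightarrow> bool" where
  "psd_perp X Y \<longleftrightarrow> 0 \<preceq> X \<and> 0 \<preceq> Y \<and> trace (X ** Y) = 0"

definition diag_mat :: "real ^ 'n \<Rightarrow> real ^ 'n ^ 'n" where
  "diag_mat p = (\<chi> i j. if i = j then p $ i else 0)"

definition diag_vec :: "real ^ 'n ^ 'n \<Rightarrow> real ^ 'n" where
  "diag_vec X = (\<chi> i. X $ i $ i)"

definition diagonal :: "real ^ 'n ^ 'n \<Rightarrow> bool" where
  "diagonal X \<longleftrightarrow> (\<forall>i j. i \<noteq> j \<longrightarrow> X $ i $ j = 0)"

definition sqrt_vec :: "real ^ 'n \<Rightarrow> real ^ 'n" where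
  "sqrt_vec v = (\<chi> i. sqrt (v $ i))"

text \<open>
  The intended use has \<open>\<nu>\<close> entrywise positive, so that the square root is defined and
  \<open>P(\<nu>)\<close> is invertible. With \<open>\<nu> \<ge> 0\<close> only, optimality can fail: take \<open>\<eta> = 2\<close>,
  \<open>g = 0\<close>, \<open>\<nu> = (0, 4)\<close>, \<open>\<Sigma> = [4, 2; 2, 1]\<close>, \<open>H = [-1, 2; 2, -2]\<close>; then
  \<open>P(\<nu>) = diag (0, 1)\<close> has a larger objective than the feasible \<open>diag (1/2, 0)\<close>.
\<close>

definition P_of :: "real \<Rightarrow> real ^ 'n \<Rightarrow> real ^ 'n ^ 'n" where
  "P_of \<eta> \<nu> = diag_mat ((1 / \<eta>) *\<^sub>R sqrt_vec \<nu>)"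

text \<open>
  The form \<open>g\<^sup>T P\<^sup>-\<^sup>1 g\<close> for diagonal \<open>P \<succeq> 0\<close>. The quotient is taken in \<^typ>\<open>ereal\<close>, not in
  \<^typ>\<open>real\<close> (where division by zero is zero): at a singular \<open>P\<close> the term \<open>g\<^sub>i\<^sup>2 / 0\<close> is
  \<open>\<infinity>\<close> for \<open>g\<^sub>i \<noteq> 0\<close> and \<open>0\<close> for \<open>g\<^sub>i = 0\<close>, the lower semicontinuous extension
  from \<open>P \<succ> 0\<close>.
\<close>

definition inv_form :: "real ^ 'n \<Rightarrow> real ^ 'n ^ 'n \<Rightarrow> ereal" where
  "inv_form g P = (\<Sum>i\<in>UNIV. ereal ((g $ i)\<^sup>2) / ereal (P $ i $ i))"

lemma inv_form_term_at_zero: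
  "ereal (x\<^sup>2) / ereal 0 = (if x = 0 then 0 else \<infinity>)"
  by (simp add: divide_ereal_def zero_ereal_def[symmetric])

definition objective :: "real \<Rightarrow> real ^ 'n \<Rightarrow> real ^ 'n ^ 'n \<Rightarrow> ereal" where
  "objective \<eta> g P = ereal (trace P) + ereal (1 / \<eta>\<^sup>2) * inv_form g P"

definition feasible :: "real ^ 'n ^ 'n \<Rightarrow> real ^ 'n ^ 'n \<Rightarrow> bool" where
  "feasible H P \<longleftrightarrow> diagonal P \<and> 0 \<preceq> P \<and> H \<preceq> 2 *\<^sub>R P"

end

theory Submission
  imports Defs
begin

text \<open>
  The multiplier of the constraint \<open>H \<preceq> 2P\<close> is \<open>\<Lambda> = 2\<Sigma>/\<eta>\<^sup>2\<close>: with \<open>p\<^sub>i = \<surd>\<nu>\<^sub>i/\<eta>\<close>, the fixed-point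
  equation for \<open>\<nu>\<close> reads \<open>g\<^sub>i\<^sup>2/\<eta>\<^sup>2 = p\<^sub>i\<^sup>2 (1 - 2\<Lambda>\<^sub>i\<^sub>i)\<close>, which is stationarity of the Lagrangian.
  Convexity of \<open>q \<mapsto> 1/q\<close> bounds each summand of the objective from below by its tangent at \<open>p\<^sub>i\<close>,
  and the linear terms of these tangents add up to \<open>tr(\<Lambda>(2Q - H)) - tr(\<Lambda>(2P - H))\<close>, where the second
  trace is zero and the first is nonnegative because both factors are positive semidefinite.
\<close>

lemma psd_mult_nth_commute:
  assumes "psd X" shows "X $ i $ j = X $ j $ i"
  using assms by (auto simp: psd_def symmetric_def transpose_def vec_eq_iff)

lemma psd_inner_commute:
  assumes "psd X" shows "x \<bullet> (X *v y) = y \<bullet> (X *v x)"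
proof -
  have "x \<bullet> (X *v y) = (x v* X) \<bullet> y"
    by (simp add: dot_lmul_matrix)
  also have "x v* X = X *v x"
    using assms by (simp add: psd_def symmetric_def flip: transpose_matrix_vector)
  finally show ?thesis by (simp add: inner_commute)
qed

lemma psd_Cauchy_Schwarz:
  assumes "psd X"
  shows "(x \<bullet> (X *v y))\<^sup>2 \<le> (x \<bullet> (X *v x)) * (y \<bullet> (X *v y))"
proof -
  define a b c where "a = y \<bullet> (X *v y)" and "b = x \<bullet> (X *v y)" and "c = x \<bullet> (X *v x)"
  have "0 \<le> a" using assms by (simp add: psd_def a_def)
  have quad: "0 \<le> c + 2 * t * b + t\<^sup>2 * a" for t
  proof -
    have "0 \<le> (x + t *\<^sub>R y) \<bullet> (X *v (x + t *\<^sub>R y))"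
      using assms by (simp add: psd_def)
    also have "\<dots> = c + 2 * t * b + t\<^sup>2 * a"
      using psd_inner_commute[OF assms, of x y]
      by (simp add: a_def b_def c_def matrix_vector_right_distrib matrix_vector_mult_scaleR
          inner_add_left inner_add_right algebra_simps power2_eq_square)
    finally show ?thesis .
  qed
  have "b\<^sup>2 \<le> c * a"
  proof (cases "a = 0")
    case True
    have "b = 0"
    proof (rule ccontr)
      assume "b \<noteq> 0"
      then have "c + 2 * (- (c + 1) / (2 * b)) * b = - 1"
        by (simp add: field_simps)
      with quad[of "- (c + 1) / (2 * b)"] True show False by simp
    qed
    with True show ?thesis by simp
  next
    case False
    with \<open>0 \<le> a\<close> have "0 < a" by simp
    have "c + 2 * (- b / a) * b + (- b / a)\<^sup>2 * a = c - b\<^sup>2 / a"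
      using False by (simp add: field_simps power2_eq_square)
    with quad[of "- b / a"] have "b\<^sup>2 / a \<le> c" by simp
    with \<open>0 < a\<close> show ?thesis by (simp add: field_simps)
  qed
  then show ?thesis by (simp add: a_def b_def c_def)
qed

lemma inner_axis_mult_axis:
  fixes X :: "real ^ 'n ^ 'n"
  shows "axis i 1 \<bullet> (X *v axis j 1) = X $ i $ j"
  by (simp add: inner_axis' matrix_vector_mult_basis column_def)

lemma psd_diag_nonneg:
  assumes "psd X" shows "0 \<le> X $ i $ i"
  using assms inner_axis_mult_axis[of i X i] by (auto simp: psd_def dest!: spec[of _ "axis i 1"])

lemma psd_diag_zero_imp_row_zero:
  assumes "psd X" "X $ i $ i = 0" shows "X $ i $ j = 0"
  using psd_Cauchy_Schwarz[OF assms(1), of "axis i 1" "axis j 1"] assms(2)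
  by (simp add: inner_axis_mult_axis)

lemma trace_matrix_mult:
  fixes X Y :: "real ^ 'n ^ 'n"
  shows "trace (X ** Y) = (\<Sum>i\<in>UNIV. \<Sum>j\<in>UNIV. X $ i $ j * Y $ j $ i)"
  by (simp add: trace_def matrix_matrix_mult_def)

text \<open>
  Subtracting from \<open>X\<close> the rank-one matrix of a pivot (a step of the Cholesky decomposition) leaves
  a positive semidefinite matrix with fewer nonzero diagonal entries. This avoids the spectral theorem.
\<close>

lemma trace_mult_psd_nonneg:
  assumes "psd X" "psd Y"
  shows "0 \<le> trace (X ** Y)"
  using assms(1)
proof (induction "card {i. X $ i $ i \<noteq> 0}" arbitrary: X rule: less_induct)
  case less
  note X = less.prems
  show ?case
  proof (cases "\<forall>i. X $ i $ i = 0")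
    case True
    then show ?thesis
      using psd_diag_zero_imp_row_zero[OF X] by (simp add: trace_matrix_mult)
  next
    case False
    then obtain k where k: "X $ k $ k \<noteq> 0" by blast
    define d where "d = X $ k $ k"
    have d: "0 < d" using psd_diag_nonneg[OF X, of k] k by (simp add: d_def)
    define v where "v = X $ k"
    define Z where "Z = (\<chi> i j. X $ i $ j - v $ i * v $ j / d)"
    have Z_mult: "Z *v x = X *v x - ((v \<bullet> x) / d) *\<^sub>R v" for x
      by (simp add: vec_eq_iff Z_def matrix_vector_mult_def inner_vec_def algebra_simps
          sum_subtractf sum_distrib_left sum_divide_distrib)
    have v_inner: "axis k 1 \<bullet> (X *v x) = v \<bullet> x" for x
      unfolding inner_axis' by (simp add: v_def matrix_vector_mult_def inner_vec_def)
    have "psd Z"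
      unfolding psd_def
    proof (intro conjI allI)
      show "symmetric Z"
        using psd_mult_nth_commute[OF X]
        by (simp add: symmetric_def transpose_def Z_def vec_eq_iff mult.commute)
      fix x
      have "(v \<bullet> x)\<^sup>2 \<le> d * (x \<bullet> (X *v x))"
        using psd_Cauchy_Schwarz[OF X, of "axis k 1" x]
        by (simp add: v_inner inner_axis_mult_axis d_def)
      then show "0 \<le> x \<bullet> (Z *v x)"
        using d by (simp add: Z_mult inner_diff_right inner_commute field_simps power2_eq_square)
    qed
    have "{i. Z $ i $ i \<noteq> 0} \<subset> {i. X $ i $ i \<noteq> 0}"
    proof
      show "{i. Z $ i $ i \<noteq> 0} \<subseteq> {i. X $ i $ i \<noteq> 0}"
        using psd_diag_zero_imp_row_zero[OF X] psd_mult_nth_commute[OF X, of k]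
        by (auto simp: Z_def v_def)
      have "k \<notin> {i. Z $ i $ i \<noteq> 0}" using d by (simp add: Z_def v_def d_def)
      with k show "{i. Z $ i $ i \<noteq> 0} \<noteq> {i. X $ i $ i \<noteq> 0}" by blast
    qed
    then have "card {i. Z $ i $ i \<noteq> 0} < card {i. X $ i $ i \<noteq> 0}"
      by (intro psubset_card_mono) auto
    then have "0 \<le> trace (Z ** Y)"
      using less.hyps \<open>psd Z\<close> by blast
    moreover have "trace (X ** Y) = trace (Z ** Y) + (v \<bullet> (Y *v v)) / d"
    proof -
      have "(v \<bullet> (Y *v v)) / d = (\<Sum>i\<in>UNIV. \<Sum>j\<in>UNIV. v $ i * v $ j / d * Y $ j $ i)"
        using psd_mult_nth_commute[OF assms(2)]
        by (simp add: inner_vec_def matrix_vector_mult_def sum_distrib_left sum_divide_distrib mult_ac)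
      then show ?thesis
        by (simp add: trace_matrix_mult Z_def left_diff_distrib sum_subtractf)
    qed
    moreover have "0 \<le> v \<bullet> (Y *v v)" using assms(2) by (simp add: psd_def)
    ultimately show ?thesis using d by simp
  qed
qed

lemma trace_mult_diff_diagonal:
  fixes S H P Q :: "real ^ 'n ^ 'n"
  assumes "diagonal P" "diagonal Q"
  shows "trace (S ** (2 *\<^sub>R Q - H)) - trace (S ** (2 *\<^sub>R P - H)) =
    (\<Sum>i\<in>UNIV. 2 * S $ i $ i * (Q $ i $ i - P $ i $ i))"
proof -
  have "trace (S ** (2 *\<^sub>R Q - H)) - trace (S ** (2 *\<^sub>R P - H)) =
      (\<Sum>i\<in>UNIV. \<Sum>j\<in>UNIV. 2 * S $ i $ j * (Q $ j $ i - P $ j $ i))"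
    by (simp add: trace_matrix_mult right_diff_distrib sum_subtractf mult_ac)
  also have "\<dots> = (\<Sum>i\<in>UNIV. \<Sum>j\<in>UNIV.
      if j = i then 2 * S $ i $ i * (Q $ i $ i - P $ i $ i) else 0)"
    using assms by (intro sum.cong refl) (auto simp: diagonal_def)
  finally show ?thesis by simp
qed

lemma objective_as_sum:
  "objective \<eta> g P =
    (\<Sum>i\<in>UNIV. ereal (P $ i $ i) + ereal (1 / \<eta>\<^sup>2) * (ereal ((g $ i)\<^sup>2) / ereal (P $ i $ i)))"
  if "\<And>i. 0 \<le> P $ i $ i"
proof -
  have "0 \<le> ereal ((g $ i)\<^sup>2) / ereal (P $ i $ i)" for i
    using that[of i] by (cases "P $ i $ i = 0") (auto simp: divide_ereal_def)
  then show ?thesis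
    by (simp add: objective_def inv_form_def trace_def sum.distrib sum_ereal_right_distrib)
qed

lemma tangent_bound:
  fixes a p q c \<eta> :: real
  assumes "0 < \<eta>" "0 < p" "0 \<le> q" "0 \<le> a" and a: "a / \<eta>\<^sup>2 = p\<^sup>2 * (1 - c)"
  shows "ereal (p + a / \<eta>\<^sup>2 / p + c * (q - p)) \<le> ereal q + ereal (1 / \<eta>\<^sup>2) * (ereal a / ereal q)"
proof (cases "q = 0")
  case True
  show ?thesis
  proof (cases "a = 0")
    case True
    with a \<open>0 < p\<close> have "c = 1" by simp
    with True \<open>q = 0\<close> show ?thesis by (simp add: divide_ereal_def)
  next
    case False
    with \<open>0 \<le> a\<close> True \<open>0 < \<eta>\<close> show ?thesis by (simp add: divide_ereal_def)
  qed
next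
  case False
  with \<open>0 \<le> q\<close> have q: "0 < q" by simp
  have "0 \<le> a / \<eta>\<^sup>2" using \<open>0 \<le> a\<close> by simp
  with a \<open>0 < p\<close> have c: "0 \<le> 1 - c" by (simp add: zero_le_mult_iff)
  have "q + a / \<eta>\<^sup>2 / q - (p + a / \<eta>\<^sup>2 / p + c * (q - p)) = (1 - c) * (q - p)\<^sup>2 / q"
    unfolding a using q \<open>0 < p\<close> by (simp add: field_simps power2_eq_square)
  also have "\<dots> \<ge> 0" using c q by simp
  finally show ?thesis using q by (simp add: field_simps)
qed

theorem proposition7:
  fixes \<eta> :: real
    and g \<nu> :: "real ^ 'n"
    and H \<Sigma> :: "real ^ 'n ^ 'n"
  assumes "\<eta> > 0"
    and "symmetric H"
    and "symmetric \<Sigma>"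
    and "\<forall>i. \<nu> $ i > 0"
    and "\<nu> = g\<^sup>2 + (4 / \<eta>\<^sup>2) *\<^sub>R (\<nu> * diag_vec \<Sigma>)"
    and "psd_perp \<Sigma> (2 *\<^sub>R P_of \<eta> \<nu> - H)"
  shows "is_arg_min (objective \<eta> g) (feasible H) (P_of \<eta> \<nu>)"
proof -
  define P where "P = P_of \<eta> \<nu>"
  define c where "c i = 4 * \<Sigma> $ i $ i / \<eta>\<^sup>2" for i
  have P_nth: "P $ i $ i = sqrt (\<nu> $ i) / \<eta>" for i
    by (simp add: P_def P_of_def diag_mat_def sqrt_vec_def)
  have diagP: "diagonal P"
    by (simp add: P_def P_of_def diag_mat_def diagonal_def)
  have P_pos: "0 < P $ i $ i" for i
    using assms(1,4) by (simp add: P_nth)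
  have stationary: "(g $ i)\<^sup>2 / \<eta>\<^sup>2 = (P $ i $ i)\<^sup>2 * (1 - c i)" for i
  proof -
    have "\<nu> $ i = (g $ i)\<^sup>2 + 4 / \<eta>\<^sup>2 * (\<nu> $ i * \<Sigma> $ i $ i)"
      using arg_cong[OF assms(5), of "\<lambda>x. x $ i"]
      by (simp add: diag_vec_def power2_eq_square)
    moreover have "(P $ i $ i)\<^sup>2 = \<nu> $ i / \<eta>\<^sup>2"
      using assms(4) by (simp add: P_nth power_divide less_imp_le)
    moreover from calculation(1) have "(g $ i)\<^sup>2 = \<nu> $ i * (1 - c i)"
      by (simp add: c_def right_diff_distrib)
    ultimately show ?thesis by simp
  qed
  have psdS: "psd \<Sigma>" and psdP: "psd (2 *\<^sub>R P - H)" and perp: "trace (\<Sigma> ** (2 *\<^sub>R P - H)) = 0"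
    using assms(6) by (simp_all add: psd_perp_def loewner_le_def P_def)
  have "psd P"
    unfolding psd_def
  proof (intro conjI allI)
    show "symmetric P"
      using diagP by (auto simp: symmetric_def transpose_def vec_eq_iff diagonal_def)
        (metis (full_types))
    fix x
    have "P *v x = (\<chi> i. P $ i $ i * x $ i)"
    proof -
      have "(\<Sum>j\<in>UNIV. P $ i $ j * x $ j) = (\<Sum>j\<in>UNIV. if j = i then P $ i $ i * x $ i else 0)" for i
        using diagP by (intro sum.cong refl) (auto simp: diagonal_def)
      then show ?thesis by (simp add: vec_eq_iff matrix_vector_mult_def)
    qed
    then have "x \<bullet> (P *v x) = (\<Sum>i\<in>UNIV. P $ i $ i * (x $ i)\<^sup>2)"
      by (simp add: inner_vec_def power2_eq_square mult_ac)
    also have "\<dots> \<ge> 0"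
      using P_pos by (intro sum_nonneg mult_nonneg_nonneg) (auto simp: less_imp_le)
    finally show "0 \<le> x \<bullet> (P *v x)" .
  qed
  with diagP psdP have feas: "feasible H P"
    by (simp add: feasible_def loewner_le_def)
  have optimal: "objective \<eta> g P \<le> objective \<eta> g Q" if "feasible H Q" for Q
  proof -
    have diagQ: "diagonal Q" and Q: "psd Q" and psdQ: "psd (2 *\<^sub>R Q - H)"
      using that by (simp_all add: feasible_def loewner_le_def)
    have "0 \<le> 2 / \<eta>\<^sup>2 * trace (\<Sigma> ** (2 *\<^sub>R Q - H))"
      using trace_mult_psd_nonneg[OF psdS psdQ] by simp
    also have "\<dots> = 2 / \<eta>\<^sup>2 * (\<Sum>i\<in>UNIV. 2 * \<Sigma> $ i $ i * (Q $ i $ i - P $ i $ i))"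
      using trace_mult_diff_diagonal[OF diagP diagQ, of \<Sigma> H] perp by simp
    also have "\<dots> = (\<Sum>i\<in>UNIV. c i * (Q $ i $ i - P $ i $ i))"
      by (simp add: c_def sum_distrib_left field_simps)
    finally have slack: "0 \<le> (\<Sum>i\<in>UNIV. c i * (Q $ i $ i - P $ i $ i))" .
    have "objective \<eta> g P = ereal (\<Sum>i\<in>UNIV. P $ i $ i + (g $ i)\<^sup>2 / \<eta>\<^sup>2 / P $ i $ i)"
    proof -
      have "ereal (P $ i $ i) + ereal (1 / \<eta>\<^sup>2) * (ereal ((g $ i)\<^sup>2) / ereal (P $ i $ i)) =
          ereal (P $ i $ i + (g $ i)\<^sup>2 / \<eta>\<^sup>2 / P $ i $ i)" for i
        using P_pos[of i] by simp
      then show ?thesis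
        using P_pos by (simp add: objective_as_sum less_imp_le del: plus_ereal.simps)
    qed
    also have "\<dots> \<le> ereal (\<Sum>i\<in>UNIV. P $ i $ i + (g $ i)\<^sup>2 / \<eta>\<^sup>2 / P $ i $ i
        + c i * (Q $ i $ i - P $ i $ i))"
      using slack by (simp add: sum.distrib)
    also have "\<dots> \<le> (\<Sum>i\<in>UNIV. ereal (Q $ i $ i)
        + ereal (1 / \<eta>\<^sup>2) * (ereal ((g $ i)\<^sup>2) / ereal (Q $ i $ i)))"
      unfolding sum_ereal[symmetric]
      using assms(1) P_pos psd_diag_nonneg[OF Q] stationary
      by (intro sum_mono tangent_bound) auto
    also have "\<dots> = objective \<eta> g Q"
      using psd_diag_nonneg[OF Q] by (simp add: objective_as_sum)
    finally show ?thesis .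
  qed
  show ?thesis
    unfolding is_arg_min_def P_def[symmetric] using feas optimal by (auto simp: not_less)
qed

end
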